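(* Let $f(\cdot;i):\mathbb{R}^d\to\mathbb{R}$, $i\in[n]$, and $F(w)=\frac1n\sum_{i=1}^n f(w;i)$. Assume: (a) $\mathrm{dom}(F)\neq\emptyset$ and $F_*:=\inf_{w\in\mathbb{R}^d}F(w)>-\infty$; (b) there is $L>0$ such that for every $i\in[n]$ and all $w,w'\in\mathrm{dom}(F)$, $\|\nabla f(w;i)-\nabla f(w';i)\|\le L\|w-w'\|$; (c) there are finite constants $\Theta,\sigma\ge 0$ such that for all $w\in\mathrm{dom}(F)$, $\frac1n\sum_{i=1}^n\|\nabla f(w;i)-\nabla F(w)\|^2\le\Theta\|\nabla F(w)\|^2+\sigma^2$. Let $0\le\beta<1$ and $K:=\max\left\{\frac52,\frac{9(5-3\beta)(\Theta+1)}{1-\beta}\right\}$. Given an epoch budget $T\ge2$ and a constant $\gamma>0$, run the SMG algorithm (described in the context), with any choice of permutations $\pi^{(t)}$, momentum weight $\beta$, and the cosine learning rate $$\eta_t:=\frac{\gamma}{T^{1/3}}\left(1+\cos\frac{t\pi}{T}\right),\qquad t=1,2,\dots,T$$ (here $\pi=3.14159\ldots$), assumed to satisfy $\eta_t\le\frac{1}{L\sqrt K}$ for all $t=1,\dots,T$. Then $$\mathbb{E}\big[\|\nabla F(\hat w_T)\|^2\big]\le\frac{1}{T^{2/3}}\left(\frac{8[F(\tilde w_0)-F_*]}{(1-\beta)\gamma}+\frac{144\sigma^2(5-3\beta)L^2\gamma^2}{1-\beta}\right).$$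
   Context: $[n]=\{1,\dots,n\}$; $\|\cdot\|$ is the Euclidean norm; $\mathbb{E}$ is expectation over all randomness (permutations, if random, and output). Since each $f(\cdot;i)$ is real-valued on $\mathbb{R}^d$, $\mathrm{dom}(F)=\mathbb{R}^d$; each $f(\cdot;i)$ is differentiable. SMG algorithm (Shuffling Momentum Gradient), with parameters $\beta$, number of epochs $T\ge1$, and $\eta_t$: Choose $\tilde w_0\in\mathbb{R}^d$ (deterministic) and set $\tilde m_0:=0$. For $t=1,\dots,T$: set $w_0^{(t)}:=\tilde w_{t-1}$, $m_0^{(t)}:=\tilde m_{t-1}$, $v_0^{(t)}:=0$; generate an arbitrary deterministic or random permutation $\pi^{(t)}$ of $[n]$; for $i=0,\dots,n-1$ put $g_i^{(t)}:=\nabla f(w_i^{(t)};\pi^{(t)}(i+1))$ and $$m_{i+1}^{(t)}:=\beta m_0^{(t)}+(1-\beta)g_i^{(t)},\quad v_{i+1}^{(t)}:=v_i^{(t)}+\tfrac1n g_i^{(t)},\quad w_{i+1}^{(t)}:=w_i^{(t)}-\tfrac{\eta_t}{n}m_{i+1}^{(t)};$$ then set $\tilde w_t:=w_n^{(t)}$ and $\tilde m_t:=v_n^{(t)}$. Output: $\hat w_T\in\{\tilde w_0,\dots,\tilde w_{T-1}\}$ chosen at random (independently of the permutations) with probability $\mathbb{P}[\hat w_T=\tilde w_{t-1}]=\eta_t/\sum_{s=1}^T\eta_s$. *)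

theory Defs
  imports "HOL-Probability.Probability"
begin

definition gradient :: "('a::real_inner \<Rightarrow> real) \<Rightarrow> 'a \<Rightarrow> 'a" where
  "gradient f x = (THE D. GDERIV f x :> D)"

definition finite_sum_objective ::
    "nat \<Rightarrow> (nat \<Rightarrow> 'a \<Rightarrow> real) \<Rightarrow> 'a \<Rightarrow> real" where
  "finite_sum_objective n f w = (1 / real n) * (\<Sum>i=1..n. f i w)"

(* One epoch with starting point w0, momentum m0, learning rate eta and permutation p of {1..n}:
   smg_epoch ... i is the triple (w_i, m_i, v_i). The momentum update uses m0, not m_i. *)
primrec smg_epoch ::
    "(nat \<Rightarrow> 'a::real_inner \<Rightarrow> real) \<Rightarrow> nat \<Rightarrow> real \<Rightarrow> real \<Rightarrow> (nat \<Rightarrow> nat) \<Rightarrow> 'a \<Rightarrow> 'a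
      \<Rightarrow> nat \<Rightarrow> 'a \<times> 'a \<times> 'a" where
  "smg_epoch f n \<beta> \<eta> p w0 m0 0 = (w0, m0, 0)"
| "smg_epoch f n \<beta> \<eta> p w0 m0 (Suc i) =
     (let (w, m, v) = smg_epoch f n \<beta> \<eta> p w0 m0 i;
          g = gradient (f (p (Suc i))) w;
          m' = \<beta> *\<^sub>R m0 + (1 - \<beta>) *\<^sub>R g;
          v' = v + (1 / real n) *\<^sub>R g;
          w' = w - (\<eta> / real n) *\<^sub>R m'
      in (w', m', v'))"

(* The pair (w~_t, m~_t) after t epochs. The momentum carried over is the gradient average v_n
   of the epoch, not its last m_n. Only eta and p at indices 1, ..., t are used. *)
primrec smg_state ::
    "(nat \<Rightarrow> 'a::real_inner \<Rightarrow> real) \<Rightarrow> nat \<Rightarrow> real \<Rightarrow> (nat \<Rightarrow> real) \<Rightarrow> (nat \<Rightarrow> nat \<Rightarrow> nat) \<Rightarrow> 'a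
      \<Rightarrow> nat \<Rightarrow> 'a \<times> 'a" where
  "smg_state f n \<beta> \<eta> p w0 0 = (w0, 0)"
| "smg_state f n \<beta> \<eta> p w0 (Suc t) =
     (let (w, m) = smg_state f n \<beta> \<eta> p w0 t;
          (w', m', v') = smg_epoch f n \<beta> (\<eta> (Suc t)) (p (Suc t)) w m n
      in (w', v'))"

definition smg_iterate ::
    "(nat \<Rightarrow> 'a::real_inner \<Rightarrow> real) \<Rightarrow> nat \<Rightarrow> real \<Rightarrow> (nat \<Rightarrow> real) \<Rightarrow> (nat \<Rightarrow> nat \<Rightarrow> nat) \<Rightarrow> 'a
      \<Rightarrow> nat \<Rightarrow> 'a" where
  "smg_iterate f n \<beta> \<eta> p w0 t = fst (smg_state f n \<beta> \<eta> p w0 t)"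

(* Permutations of {1..n} as a finite discrete measurable space. *)
abbreviation perm_space :: "nat \<Rightarrow> (nat \<Rightarrow> nat) measure" where
  "perm_space n \<equiv> count_space {p. p permutes {1..n}}"

(* The library's indep_var needs both variables to have the same value type; this is the same
   notion, independence of the generated sigma-algebras, for different value types. *)
definition (in prob_space) indep_rvs ::
    "'b measure \<Rightarrow> ('a \<Rightarrow> 'b) \<Rightarrow> 'c measure \<Rightarrow> ('a \<Rightarrow> 'c) \<Rightarrow> bool" where
  "indep_rvs N X N' Y \<longleftrightarrow>
     random_variable N X \<and> random_variable N' Y \<and>
     indep_set (sets (vimage_algebra (space M) X N)) (sets (vimage_algebra (space M) Y N'))"

end

theory Submission
  imports Defs
begin

text \<open>
  Write \<open>x\<^sub>t\<close> for the iterate after \<open>t\<close> epochs, \<open>G\<^sub>t\<close> for the average of the stochastic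
  gradients computed during epoch \<open>t\<close> (with \<open>G\<^sub>0 = 0\<close>), and \<open>u\<^sub>t = \<beta> G\<^sub>t\<^sub>-\<^sub>1 + (1 - \<beta>) G\<^sub>t\<close>. Since all
  steps of an epoch use the same old momentum, a whole epoch is one step
  \<open>x\<^sub>t = x\<^sub>t\<^sub>-\<^sub>1 - \<eta>\<^sub>t u\<^sub>t\<close>, and the descent inequality for the \<open>L\<close>-smooth function \<open>F\<close> reduces
  everything to how well \<open>u\<^sub>t\<close> approximates the gradient of \<open>F\<close> at \<open>x\<^sub>t\<^sub>-\<^sub>1\<close>. By smoothness the two
  errors are controlled by the mean squared distance \<open>D\<^sub>t\<close> of the inner iterates of epoch \<open>t\<close> from its
  start \<open>x\<^sub>t\<^sub>-\<^sub>1\<close>, and by the mean squared distance \<open>E\<^sub>t\<^sub>-\<^sub>1\<close> of the inner iterates of the previous epoch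
  from its end, which is again \<open>x\<^sub>t\<^sub>-\<^sub>1\<close>. In the first epoch the old momentum is zero and merely fails
  to contribute to the descent.

  The inner iterates deviate from the segment between \<open>x\<^sub>t\<^sub>-\<^sub>1\<close> and \<open>x\<^sub>t\<close> only through partial sums of
  the centred gradients \<open>g\<^sub>j - G\<^sub>t\<close>. Hence, for a learning rate with \<open>L\<^sup>2 \<eta>\<^sub>t\<^sup>2 (\<Theta> + 1) \<le> 1/45\<close>,
  \<open>D\<^sub>t \<le> \<eta>\<^sub>t\<^sup>2 (9/4 |u\<^sub>t|\<^sup>2 + 9/2 (1 - \<beta>)\<^sup>2 V)\<close> for every order of the components
  (lemma \<open>smg_epoch_drift\<close>), where \<open>V\<close> is the variance bound at \<open>x\<^sub>t\<^sub>-\<^sub>1\<close>, and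
  \<open>E\<^sub>t \<le> 2 D\<^sub>t + 2 \<eta>\<^sub>t\<^sup>2 |u\<^sub>t|\<^sup>2\<close>. For such a learning rate the terms in
  \<open>|u\<^sub>t|\<^sup>2\<close> are absorbed by the term \<open>- \<eta>\<^sub>t/2 |u\<^sub>t|\<^sup>2\<close> of the descent inequality, the part of \<open>V\<close> with
  factor \<open>\<Theta>\<close> by the squared gradient norm, and only the part with factor \<open>\<sigma>\<^sup>2\<close> remains (lemma
  \<open>smg_epoch_progress\<close>). The errors \<open>E\<^sub>t\<close> telescope because the learning rate decreases (lemma
  \<open>smg_progress\<close>), which gives, for every fixed sequence of permutations, a bound on the sum of
  \<open>\<eta>\<^sub>t |\<nabla>F(x\<^sub>t\<^sub>-\<^sub>1)|\<^sup>2\<close>.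

  The cosines sum to \<open>-1\<close>, so the learning rates sum to \<open>\<gamma> (T - 1) / T\<^bsup>1/3\<^esup>\<close>, while their cubes
  sum to at most \<open>8 \<gamma>\<^sup>3\<close>. Finally, the output index is independent of the permutations and has
  weights proportional to \<open>\<eta>\<^sub>t\<close>, so the expectation is an average over permutation sequences of the
  weighted sums just bounded.
\<close>

section \<open>Gradients and the descent inequality\<close>

lemma gradient_eqI:
  assumes "GDERIV f x :> D"
  shows "gradient f x = D"
  unfolding gradient_def
proof (rule the_equality)
  fix D' assume "GDERIV f x :> D'"
  then have "(\<lambda>h. h \<bullet> D') = (\<lambda>h. h \<bullet> D)"
    using assms unfolding gderiv_def by (rule has_derivative_unique)
  then have "(D' - D) \<bullet> D' = (D' - D) \<bullet> D"
    by meson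
  then have "(D' - D) \<bullet> (D' - D) = 0"
    by (simp add: inner_diff_right)
  then show "D' = D"
    by simp
qed (fact assms)

lemma GDERIV_gradient:
  fixes f :: "'a::euclidean_space \<Rightarrow> real"
  assumes "f differentiable (at x)"
  shows "GDERIV f x :> gradient f x"
proof -
  obtain f' where f': "(f has_derivative f') (at x)"
    using assms unfolding differentiable_def by blast
  then interpret linear f'
    by (rule has_derivative_linear)
  have "f' = (\<lambda>h. h \<bullet> (\<Sum>b\<in>Basis. f' b *\<^sub>R b))"
  proof
    fix h
    have "f' h = f' (\<Sum>b\<in>Basis. (h \<bullet> b) *\<^sub>R b)"
      by (simp add: euclidean_representation)
    also have "\<dots> = (\<Sum>b\<in>Basis. (h \<bullet> b) * f' b)"
      by (simp add: sum scale)
    also have "\<dots> = h \<bullet> (\<Sum>b\<in>Basis. f' b *\<^sub>R b)"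
      by (simp add: inner_sum_right mult.commute)
    finally show "f' h = h \<bullet> (\<Sum>b\<in>Basis. f' b *\<^sub>R b)" .
  qed
  then have "GDERIV f x :> (\<Sum>b\<in>Basis. f' b *\<^sub>R b)"
    using f' unfolding gderiv_def by metis
  then show ?thesis
    using gradient_eqI by metis
qed

lemma GDERIV_finite_sum_objective:
  assumes "\<And>i. i \<in> {1..n} \<Longrightarrow> GDERIV (f i) x :> D i"
  shows "GDERIV (finite_sum_objective n f) x :> (1 / real n) *\<^sub>R (\<Sum>i=1..n. D i)"
proof -
  have "(f i has_derivative (\<lambda>h. h \<bullet> D i)) (at x)" if "i \<in> {1..n}" for i
    using assms[OF that] by (simp add: gderiv_def)
  then have "((\<lambda>w. (1 / real n) * (\<Sum>i=1..n. f i w)) has_derivative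
      (\<lambda>h. (1 / real n) * (\<Sum>i=1..n. h \<bullet> D i))) (at x)"
    by (intro has_derivative_mult_right has_derivative_sum) auto
  then show ?thesis
    unfolding gderiv_def finite_sum_objective_def[abs_def]
    by (simp add: inner_sum_right)
qed

lemma descent_inequality:
  fixes F :: "'a::real_inner \<Rightarrow> real"
  assumes deriv: "\<And>x. GDERIV F x :> gradF x"
    and lipschitz: "\<And>x y. norm (gradF x - gradF y) \<le> L * norm (x - y)"
  shows "F y \<le> F x + gradF x \<bullet> (y - x) + L / 2 * (norm (y - x))\<^sup>2"
proof -
  define d where "d = y - x"
  \<comment> \<open>The defect of the claimed inequality along the segment, a nonincreasing function of \<open>s\<close>.\<close>
  define \<phi> where
    "\<phi> s = F (x + s *\<^sub>R d) - s * (gradF x \<bullet> d) - L / 2 * s\<^sup>2 * (norm d)\<^sup>2" for s :: real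
  have \<phi>': "(\<phi> has_real_derivative
      (gradF (x + s *\<^sub>R d) - gradF x) \<bullet> d - L * s * (norm d)\<^sup>2) (at s)" for s
  proof -
    have "(F has_derivative (\<lambda>h. h \<bullet> gradF (x + s *\<^sub>R d))) (at (x + s *\<^sub>R d))"
      using deriv by (simp add: gderiv_def)
    then have "((\<lambda>s. F (x + s *\<^sub>R d)) has_derivative
        (\<lambda>h. (h *\<^sub>R d) \<bullet> gradF (x + s *\<^sub>R d))) (at s)"
      by (rule has_derivative_compose[rotated]) (auto intro!: derivative_eq_intros)
    then have "((\<lambda>s. F (x + s *\<^sub>R d)) has_real_derivative gradF (x + s *\<^sub>R d) \<bullet> d) (at s)"
      unfolding has_field_derivative_def
      by (simp add: inner_commute mult_commute_abs)
    then show ?thesis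
      unfolding \<phi>_def
      by (auto intro!: derivative_eq_intros simp: inner_diff_left)
  qed
  have "\<phi> 1 \<le> \<phi> 0"
  proof (rule DERIV_nonpos_imp_nonincreasing[of 0 1 \<phi>])
    fix s :: real assume s: "0 \<le> s" "s \<le> 1"
    have "(gradF (x + s *\<^sub>R d) - gradF x) \<bullet> d \<le> norm (gradF (x + s *\<^sub>R d) - gradF x) * norm d"
      by (rule norm_cauchy_schwarz)
    also have "\<dots> \<le> (L * norm (s *\<^sub>R d)) * norm d"
      using lipschitz[of "x + s *\<^sub>R d" x] by (intro mult_right_mono) auto
    also have "\<dots> = L * s * (norm d)\<^sup>2"
      using s by (simp add: power2_eq_square)
    finally show "\<exists>D. (\<phi> has_real_derivative D) (at s) \<and> D \<le> 0"
      using \<phi>' by force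
  qed simp
  then show ?thesis
    by (simp add: \<phi>_def d_def algebra_simps)
qed

section \<open>Inequalities for averages of vectors\<close>

lemma norm_add_power2_le:
  fixes x y :: "'a::real_inner"
  shows "(norm (x + y))\<^sup>2 \<le> 2 * (norm x)\<^sup>2 + 2 * (norm y)\<^sup>2"
proof -
  have "(norm (x + y))\<^sup>2 + (norm (x - y))\<^sup>2 = 2 * (norm x)\<^sup>2 + 2 * (norm y)\<^sup>2"
    by (simp add: power2_norm_eq_inner algebra_simps inner_commute)
  then show ?thesis
    by (metis add_le_cancel_left add.right_neutral le_add_same_cancel1 zero_le_power2)
qed

text \<open>A partial sum is divided by the full length \<open>n\<close>, so that the Cauchy-Schwarz inequality bounds
  all of them by the same complete average.\<close>

lemma norm_partial_average_power2_le:
  fixes z :: "nat \<Rightarrow> 'a::real_inner"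
  assumes "n \<ge> 1" "i \<le> n"
  shows "(norm ((1 / real n) *\<^sub>R (\<Sum>j<i. z j)))\<^sup>2 \<le> (1 / real n) * (\<Sum>j<n. (norm (z j))\<^sup>2)"
proof -
  have "norm (\<Sum>j<i. z j) \<le> (\<Sum>j<i. norm (z j))"
    by (rule norm_sum)
  also have "\<dots> \<le> (\<Sum>j<n. norm (z j))"
    using assms by (intro sum_mono2) auto
  finally have "(norm (\<Sum>j<i. z j))\<^sup>2 \<le> (\<Sum>j<n. norm (z j))\<^sup>2"
    by (intro power_mono) auto
  also have "\<dots> \<le> real n * (\<Sum>j<n. (norm (z j))\<^sup>2)"
    using sum_squared_le_sum_of_squares[of "\<lambda>j. norm (z j)" "{..<n}"] by (simp add: mult.commute)
  finally show ?thesis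
    using assms by (simp add: power_divide power2_eq_square field_simps)
qed

text \<open>The average minimises the sum of squared distances.\<close>

lemma sum_norm_diff_average_power2_le:
  fixes g :: "nat \<Rightarrow> 'a::real_inner"
  assumes n: "n \<ge> 1" and G: "G = (1 / real n) *\<^sub>R (\<Sum>j<n. g j)"
  shows "(\<Sum>j<n. (norm (g j - G))\<^sup>2) \<le> (\<Sum>j<n. (norm (g j - d))\<^sup>2)"
proof -
  have sum_g: "(\<Sum>j<n. g j) = real n *\<^sub>R G"
    using n G by simp
  have "(norm (g j - d))\<^sup>2 = (norm (g j - G))\<^sup>2 + 2 * ((g j - G) \<bullet> (G - d)) + (norm (G - d))\<^sup>2" for j
    by (simp add: power2_norm_eq_inner algebra_simps inner_commute)
  then have "(\<Sum>j<n. (norm (g j - d))\<^sup>2) =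
      (\<Sum>j<n. (norm (g j - G))\<^sup>2) + 2 * ((\<Sum>j<n. g j - G) \<bullet> (G - d)) + real n * (norm (G - d))\<^sup>2"
    by (simp add: sum.distrib inner_sum_left sum_distrib_left)
  also have "(\<Sum>j<n. g j - G) = 0"
    by (simp add: sum_subtractf sum_g sum_constant_scaleR)
  finally show ?thesis
    by simp
qed

section \<open>One epoch\<close>

lemma smg_epoch_eq:
  fixes f :: "nat \<Rightarrow> 'a::real_inner \<Rightarrow> real" and x m :: 'a and p :: "nat \<Rightarrow> nat"
    and n :: nat and \<beta> \<eta> :: real
  defines "w \<equiv> \<lambda>i. fst (smg_epoch f n \<beta> \<eta> p x m i)"
  defines "g \<equiv> \<lambda>j. gradient (f (p (Suc j))) (w j)"
  shows "w i = x - (\<eta> / real n) *\<^sub>R (\<Sum>j<i. \<beta> *\<^sub>R m + (1 - \<beta>) *\<^sub>R g j)"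
    and "snd (snd (smg_epoch f n \<beta> \<eta> p x m i)) = (1 / real n) *\<^sub>R (\<Sum>j<i. g j)"
proof -
  have w_Suc: "w (Suc i) = w i - (\<eta> / real n) *\<^sub>R (\<beta> *\<^sub>R m + (1 - \<beta>) *\<^sub>R g i)" for i
    by (simp add: w_def g_def split_beta Let_def)
  show "w i = x - (\<eta> / real n) *\<^sub>R (\<Sum>j<i. \<beta> *\<^sub>R m + (1 - \<beta>) *\<^sub>R g j)"
  proof (induction i)
    case 0
    show ?case by (simp add: w_def)
  next
    case (Suc i)
    then show ?case
      unfolding w_Suc by (simp add: scaleR_add_right)
  qed
  show "snd (snd (smg_epoch f n \<beta> \<eta> p x m i)) = (1 / real n) *\<^sub>R (\<Sum>j<i. g j)"
    by (induction i) (simp_all add: split_beta Let_def g_def w_def scaleR_add_right)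
qed

text \<open>
  The drift of the inner iterates \<open>w j\<close> of an epoch away from its starting point \<open>x\<close>. Here \<open>g j\<close> is the
  gradient used in step \<open>j\<close>, \<open>h j\<close> the gradient of the same component at \<open>x\<close>, and \<open>d\<close> any vector around
  which the \<open>h j\<close> have mean squared deviation at most \<open>V\<close>. Expressing the old momentum through the epoch
  direction \<open>u\<close> leaves only the centred gradients \<open>g j - G\<close> in the sums, so that no multiple of
  \<open>norm d\<close> appears in the bound.
\<close>

lemma smg_epoch_drift:
  fixes g h w :: "nat \<Rightarrow> 'a::real_inner" and x m d :: 'a
  assumes n: "n \<ge> 1"
    and beta: "0 \<le> \<beta>" "\<beta> < 1"
    and small: "L\<^sup>2 * \<eta>\<^sup>2 \<le> 1 / 45"
    and w: "\<And>i. w i = x - (\<eta> / real n) *\<^sub>R (\<Sum>j<i. \<beta> *\<^sub>R m + (1 - \<beta>) *\<^sub>R g j)"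
    and lipschitz: "\<And>j. j < n \<Longrightarrow> norm (g j - h j) \<le> L * norm (w j - x)"
    and V: "(1 / real n) * (\<Sum>j<n. (norm (h j - d))\<^sup>2) \<le> V"
    and G: "G = (1 / real n) *\<^sub>R (\<Sum>j<n. g j)"
    and u: "u = \<beta> *\<^sub>R m + (1 - \<beta>) *\<^sub>R G"
    and D: "D = (1 / real n) * (\<Sum>j<n. (norm (w j - x))\<^sup>2)"
  shows "w n = x - \<eta> *\<^sub>R u"
    and "D \<le> \<eta>\<^sup>2 * (9 / 4 * (norm u)\<^sup>2 + 9 / 2 * (1 - \<beta>)\<^sup>2 * V)"
proof -
  have n0: "real n > 0" using n by simp
  have sum_eq: "(1 / real n) *\<^sub>R (\<Sum>j<i. \<beta> *\<^sub>R m + (1 - \<beta>) *\<^sub>R g j) =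
      (real i / real n) *\<^sub>R u + (1 - \<beta>) *\<^sub>R ((1 / real n) *\<^sub>R (\<Sum>j<i. g j - G))" for i
  proof -
    define X where "X = (1 / real n) *\<^sub>R (\<Sum>j<i. g j)"
    have "(1 / real n) *\<^sub>R (\<Sum>j<i. \<beta> *\<^sub>R m + (1 - \<beta>) *\<^sub>R g j) =
        (real i / real n) *\<^sub>R (\<beta> *\<^sub>R m) + (1 - \<beta>) *\<^sub>R X"
      by (simp add: X_def sum.distrib sum_constant_scaleR scaleR_sum_right[symmetric]
          scaleR_add_right)
    moreover have "(1 / real n) *\<^sub>R (\<Sum>j<i. g j - G) = X - (real i / real n) *\<^sub>R G"
      by (simp add: X_def sum_subtractf sum_constant_scaleR scaleR_diff_right)
    ultimately show ?thesis
      by (simp add: u scaleR_add_right scaleR_diff_right)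
  qed
  have w_eq: "w i - x = (- \<eta>) *\<^sub>R ((real i / real n) *\<^sub>R u
      + (1 - \<beta>) *\<^sub>R ((1 / real n) *\<^sub>R (\<Sum>j<i. g j - G)))" for i
    unfolding sum_eq[symmetric] by (simp add: w)
  have "(\<Sum>j<n. g j - G) = 0"
    using n by (simp add: G sum_subtractf sum_constant_scaleR)
  then show "w n = x - \<eta> *\<^sub>R u"
    using w_eq[of n] n0 by (simp add: algebra_simps)
  \<comment> \<open>The centred gradients are compared with \<open>d\<close>, which brings \<open>D\<close> back in; the smallness of
    \<open>L * \<eta>\<close> allows this occurrence to be absorbed at the end.\<close>
  define S where "S = (1 / real n) * (\<Sum>j<n. (norm (g j - G))\<^sup>2)"
  have "S \<le> (1 / real n) * (\<Sum>j<n. (norm (g j - d))\<^sup>2)"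
    unfolding S_def using sum_norm_diff_average_power2_le[OF n G]
    by (intro mult_left_mono) auto
  also have "\<dots> \<le> (1 / real n) * (\<Sum>j<n. 2 * L\<^sup>2 * (norm (w j - x))\<^sup>2 + 2 * (norm (h j - d))\<^sup>2)"
  proof (intro mult_left_mono sum_mono)
    fix j assume "j \<in> {..<n}"
    then have "(norm (g j - h j))\<^sup>2 \<le> (L * norm (w j - x))\<^sup>2"
      using lipschitz by (intro power_mono) auto
    then show "(norm (g j - d))\<^sup>2 \<le> 2 * L\<^sup>2 * (norm (w j - x))\<^sup>2 + 2 * (norm (h j - d))\<^sup>2"
      using norm_add_power2_le[of "g j - h j" "h j - d"] by (simp add: power_mult_distrib)
  qed simp
  also have "\<dots> = 2 * L\<^sup>2 * D + 2 * ((1 / real n) * (\<Sum>j<n. (norm (h j - d))\<^sup>2))"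
    by (simp add: D sum.distrib sum_distrib_left[symmetric] algebra_simps add_divide_distrib)
  finally have S: "S \<le> 2 * L\<^sup>2 * D + 2 * V"
    using V by linarith
  have bound: "(norm (w i - x))\<^sup>2 \<le> \<eta>\<^sup>2 * (2 * (norm u)\<^sup>2 + 2 * (1 - \<beta>)\<^sup>2 * S)" if "i < n" for i
  proof -
    have "(real i / real n)\<^sup>2 \<le> 1"
      using that by (simp add: power_le_one)
    then have u_part: "(norm ((real i / real n) *\<^sub>R u))\<^sup>2 \<le> (norm u)\<^sup>2"
      using mult_right_mono[of "(real i / real n)\<^sup>2" 1 "(norm u)\<^sup>2"]
      by (simp add: power_mult_distrib power_divide)
    have "(norm ((1 / real n) *\<^sub>R (\<Sum>j<i. g j - G)))\<^sup>2 \<le> S"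
      unfolding S_def using n that by (intro norm_partial_average_power2_le) auto
    then have "(norm ((1 - \<beta>) *\<^sub>R ((1 / real n) *\<^sub>R (\<Sum>j<i. g j - G))))\<^sup>2 \<le> (1 - \<beta>)\<^sup>2 * S"
      unfolding norm_scaleR[of "1 - \<beta>"] power_mult_distrib power2_abs
      by (intro mult_left_mono) auto
    then have "(norm ((real i / real n) *\<^sub>R u
        + (1 - \<beta>) *\<^sub>R ((1 / real n) *\<^sub>R (\<Sum>j<i. g j - G))))\<^sup>2
        \<le> 2 * (norm u)\<^sup>2 + 2 * ((1 - \<beta>)\<^sup>2 * S)"
      using u_part by (intro order_trans[OF norm_add_power2_le] add_mono mult_left_mono) auto
    then show ?thesis
      unfolding w_eq norm_scaleR[of "- \<eta>"] power_mult_distrib power2_abs power2_minus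
      by (intro mult_left_mono) (auto simp: mult.assoc)
  qed
  have "D \<le> (1 / real n) * (\<Sum>j<n. \<eta>\<^sup>2 * (2 * (norm u)\<^sup>2 + 2 * (1 - \<beta>)\<^sup>2 * S))"
    unfolding D using bound by (intro mult_left_mono sum_mono) auto
  also have "\<dots> = \<eta>\<^sup>2 * (2 * (norm u)\<^sup>2 + 2 * (1 - \<beta>)\<^sup>2 * S)"
    using n0 by simp
  also have "\<dots> \<le> \<eta>\<^sup>2 * (2 * (norm u)\<^sup>2 + 2 * (1 - \<beta>)\<^sup>2 * (2 * L\<^sup>2 * D + 2 * V))"
    using S by (intro mult_left_mono add_left_mono) auto
  finally have D_le: "D \<le> 2 * (\<eta>\<^sup>2 * (norm u)\<^sup>2) + 4 * ((1 - \<beta>)\<^sup>2 * ((L\<^sup>2 * \<eta>\<^sup>2) * D))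
      + 4 * (\<eta>\<^sup>2 * ((1 - \<beta>)\<^sup>2 * V))"
    by (simp add: algebra_simps)
  have D0: "D \<ge> 0"
    unfolding D by (simp add: sum_nonneg)
  have V0: "V \<ge> 0"
    using V n0 by (smt (verit) sum_nonneg zero_le_power2 zero_le_divide_1_iff zero_le_mult_iff)
  have "(1 - \<beta>)\<^sup>2 * ((L\<^sup>2 * \<eta>\<^sup>2) * D) \<le> 1 * ((1 / 45) * D)"
    using beta small D0 by (intro mult_mono) (auto simp: power_le_one)
  moreover have "0 \<le> \<eta>\<^sup>2 * (norm u)\<^sup>2" "0 \<le> \<eta>\<^sup>2 * ((1 - \<beta>)\<^sup>2 * V)"
    using V0 by auto
  moreover have "\<eta>\<^sup>2 * (9 / 4 * (norm u)\<^sup>2 + 9 / 2 * (1 - \<beta>)\<^sup>2 * V) =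
      9 / 4 * (\<eta>\<^sup>2 * (norm u)\<^sup>2) + 9 / 2 * (\<eta>\<^sup>2 * ((1 - \<beta>)\<^sup>2 * V))"
    by (simp add: algebra_simps)
  ultimately show "D \<le> \<eta>\<^sup>2 * (9 / 4 * (norm u)\<^sup>2 + 9 / 2 * (1 - \<beta>)\<^sup>2 * V)"
    using D_le by linarith
qed

text \<open>
  The assumptions on a finite-sum objective and the momentum weight: component gradients that are
  \<open>L\<close>-Lipschitz, and a variance of the component gradients that may grow with the gradient of the
  average \<open>F\<close>. Boundedness from below is not needed for the estimates on the epochs.
\<close>

locale smg_problem =
  fixes f :: "nat \<Rightarrow> 'a::euclidean_space \<Rightarrow> real" and F :: "'a \<Rightarrow> real"
    and n :: nat and L \<Theta> \<sigma> \<beta> :: real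
  assumes n: "n \<ge> 1"
    and F: "F = finite_sum_objective n f"
    and differentiable: "i \<in> {1..n} \<Longrightarrow> f i differentiable (at w)"
    and smooth: "i \<in> {1..n} \<Longrightarrow>
      norm (gradient (f i) w - gradient (f i) w') \<le> L * norm (w - w')"
    and Theta_nonneg: "\<Theta> \<ge> 0"
    and variance: "(1 / real n) * (\<Sum>i=1..n. (norm (gradient (f i) w - gradient F w))\<^sup>2)
      \<le> \<Theta> * (norm (gradient F w))\<^sup>2 + \<sigma>\<^sup>2"
    and beta: "0 \<le> \<beta>" "\<beta> < 1"
begin

lemma GDERIV_F_average: "GDERIV F x :> (1 / real n) *\<^sub>R (\<Sum>i=1..n. gradient (f i) x)"
  unfolding F by (intro GDERIV_finite_sum_objective GDERIV_gradient differentiable)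

lemma gradient_F: "gradient F x = (1 / real n) *\<^sub>R (\<Sum>i=1..n. gradient (f i) x)"
  using GDERIV_F_average by (rule gradient_eqI)

lemma GDERIV_F: "GDERIV F x :> gradient F x"
  using GDERIV_F_average by (simp add: gradient_F)

lemma gradient_F_lipschitz: "norm (gradient F x - gradient F y) \<le> L * norm (x - y)"
proof -
  have "norm (\<Sum>i=1..n. gradient (f i) x - gradient (f i) y) \<le> (\<Sum>i=1..n. L * norm (x - y))"
    by (intro sum_norm_le smooth)
  then show ?thesis
    using n unfolding gradient_F scaleR_diff_right[symmetric] sum_subtractf[symmetric]
    by (simp add: field_simps)
qed

text \<open>The step with index \<open>j\<close> uses the component \<open>p (Suc j)\<close>.\<close>

lemma sum_permuted:
  assumes "p permutes {1..n}"
  shows "(\<Sum>j<n. \<phi> (p (Suc j))) = (\<Sum>i=1..n. \<phi> i)"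
proof -
  have "(\<Sum>j<n. \<phi> (p (Suc j))) = (\<Sum>i=1..n. \<phi> (p i))"
    by (rule sum.reindex_bij_witness[of _ "\<lambda>i. i - 1" Suc]) auto
  also have "\<dots> = (\<Sum>i=1..n. \<phi> i)"
    using sum.permute[OF assms, of \<phi>] by (simp add: o_def)
  finally show ?thesis .
qed

text \<open>
  The average gradient of an epoch is close to the gradient of \<open>F\<close> at any point that is close to the
  inner iterates. It is used both at the start and at the end of an epoch.
\<close>

lemma average_gradient_error:
  assumes p: "p permutes {1..n}"
  shows "(norm ((1 / real n) *\<^sub>R (\<Sum>j<n. gradient (f (p (Suc j))) (w j)) - gradient F y))\<^sup>2
    \<le> L\<^sup>2 * ((1 / real n) * (\<Sum>j<n. (norm (w j - y))\<^sup>2))"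
proof -
  let ?z = "\<lambda>j. gradient (f (p (Suc j))) (w j) - gradient (f (p (Suc j))) y"
  have "(1 / real n) *\<^sub>R (\<Sum>j<n. gradient (f (p (Suc j))) (w j)) - gradient F y
      = (1 / real n) *\<^sub>R (\<Sum>j<n. ?z j)"
    unfolding gradient_F sum_permuted[OF p, of "\<lambda>i. gradient (f i) y", symmetric]
    by (simp add: sum_subtractf scaleR_diff_right)
  then have "(norm ((1 / real n) *\<^sub>R (\<Sum>j<n. gradient (f (p (Suc j))) (w j)) - gradient F y))\<^sup>2
      \<le> (1 / real n) * (\<Sum>j<n. (norm (?z j))\<^sup>2)"
    using norm_partial_average_power2_le[of n n ?z] n by simp
  also have "\<dots> \<le> (1 / real n) * (\<Sum>j<n. (L * norm (w j - y))\<^sup>2)"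
  proof (intro mult_left_mono sum_mono power_mono smooth)
    show "p (Suc j) \<in> {1..n}" if "j \<in> {..<n}" for j
      using permutes_in_image[OF p, of "Suc j"] that by auto
  qed auto
  also have "\<dots> = L\<^sup>2 * ((1 / real n) * (\<Sum>j<n. (norm (w j - y))\<^sup>2))"
    by (simp add: power_mult_distrib sum_distrib_left mult.left_commute)
  finally show ?thesis .
qed

text \<open>
  The number \<open>e\<close> measures how far the momentum \<open>m\<close> may be from the gradient of \<open>F\<close> at \<open>x\<close>. The
  hypothesis relating them follows from \<open>norm (m - gradient F x)\<^sup>2 \<le> L\<^sup>2 * e\<close>, but, unlike that inequality, it also
  holds for \<open>m = 0\<close> and \<open>e = 0\<close>, the situation before the first epoch. One epoch restores it with
  a new error \<open>e'\<close>.
\<close>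

lemma smg_epoch_progress:
  assumes p: "p permutes {1..n}"
    and eta: "\<eta> \<ge> 0" "L\<^sup>2 * \<eta>\<^sup>2 * (\<Theta> + 1) \<le> 1 / 45"
    and momentum: "(norm m)\<^sup>2 - L\<^sup>2 * e \<le> 2 * (gradient F x \<bullet> m)"
    and epoch: "smg_epoch f n \<beta> \<eta> p x m n = (x', m\<^sub>n, m')"
  shows "\<exists>e'\<ge>0. (norm m')\<^sup>2 - L\<^sup>2 * e' \<le> 2 * (gradient F x' \<bullet> m') \<and>
    F x' + \<eta> * \<beta> / 2 * L\<^sup>2 * e' + (1 - \<beta>) / 4 * (\<eta> * (norm (gradient F x))\<^sup>2)
      \<le> F x + \<eta> * \<beta> / 2 * L\<^sup>2 * e + 9 / 4 * (1 - \<beta>) * \<sigma>\<^sup>2 * L\<^sup>2 * \<eta> ^ 3"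
proof -
  define w where "w i = fst (smg_epoch f n \<beta> \<eta> p x m i)" for i
  define g where "g j = gradient (f (p (Suc j))) (w j)" for j
  define h where "h j = gradient (f (p (Suc j))) x" for j
  define d where "d = gradient F x"
  define u where "u = \<beta> *\<^sub>R m + (1 - \<beta>) *\<^sub>R m'"
  define V where "V = \<Theta> * (norm d)\<^sup>2 + \<sigma>\<^sup>2"
  define D where "D = (1 / real n) * (\<Sum>j<n. (norm (w j - x))\<^sup>2)"
  define E where "E = (1 / real n) * (\<Sum>j<n. (norm (w j - x'))\<^sup>2)"
  define s where "s = L\<^sup>2 * \<eta>\<^sup>2"
  have x': "x' = w n"
    using epoch by (simp add: w_def)
  have m': "m' = (1 / real n) *\<^sub>R (\<Sum>j<n. g j)"
    using smg_epoch_eq(2)[of f n \<beta> \<eta> p x m n] epoch by (simp add: w_def g_def)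
  have w_eq: "w i = x - (\<eta> / real n) *\<^sub>R (\<Sum>j<i. \<beta> *\<^sub>R m + (1 - \<beta>) *\<^sub>R g j)" for i
    using smg_epoch_eq(1)[of f n \<beta> \<eta> p x m i] by (simp add: w_def g_def)
  have s0: "0 \<le> s" and s_Theta: "s * \<Theta> + s \<le> 1 / 45"
    using eta(2) by (simp_all add: s_def algebra_simps)
  then have s_small: "s \<le> 1 / 45"
    using Theta_nonneg mult_nonneg_nonneg[of s \<Theta>] by linarith
  have V0: "V \<ge> 0"
    using Theta_nonneg by (simp add: V_def)
  have gh: "norm (g j - h j) \<le> L * norm (w j - x)" if "j < n" for j
    unfolding g_def h_def using permutes_in_image[OF p, of "Suc j"] that by (intro smooth) auto
  have hV: "(1 / real n) * (\<Sum>j<n. (norm (h j - d))\<^sup>2) \<le> V"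
    unfolding h_def sum_permuted[OF p, of "\<lambda>i. (norm (gradient (f i) x - d))\<^sup>2"]
    unfolding d_def V_def by (rule variance)
  note drift = smg_epoch_drift[OF n beta s_small[unfolded s_def] w_eq gh hV m' u_def D_def]
  have step: "x' - x = - \<eta> *\<^sub>R u"
    using drift(1) by (simp add: x')
  have E_le: "E \<le> 2 * D + 2 * \<eta>\<^sup>2 * (norm u)\<^sup>2"
  proof -
    have "(norm (w j - x'))\<^sup>2 \<le> 2 * (norm (w j - x))\<^sup>2 + 2 * \<eta>\<^sup>2 * (norm u)\<^sup>2" for j
      using norm_add_power2_le[of "w j - x" "x - x'"] step
      by (simp add: norm_minus_commute[of x x'] power_mult_distrib)
    then have "E \<le> (1 / real n) * (\<Sum>j<n. 2 * (norm (w j - x))\<^sup>2 + 2 * \<eta>\<^sup>2 * (norm u)\<^sup>2)"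
      unfolding E_def by (intro mult_left_mono sum_mono) auto
    also have "\<dots> = 2 * D + 2 * \<eta>\<^sup>2 * (norm u)\<^sup>2"
      using n by (simp add: D_def sum.distrib sum_distrib_left[symmetric] field_simps)
    finally show ?thesis .
  qed
  \<comment> \<open>By polarisation, a bound on the distance of \<open>m'\<close> from a gradient is one on their inner product.\<close>
  have error_x: "(norm m')\<^sup>2 + (norm d)\<^sup>2 - L\<^sup>2 * D \<le> 2 * (d \<bullet> m')"
    using average_gradient_error[OF p, of w x, folded g_def, folded m' D_def d_def]
    by (simp add: dot_norm_neg[of d m'] norm_minus_commute)
  have "(norm m')\<^sup>2 + (norm (gradient F x'))\<^sup>2 - L\<^sup>2 * E \<le> 2 * (gradient F x' \<bullet> m')"
    using average_gradient_error[OF p, of w x', folded g_def, folded m' E_def]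
    by (simp add: dot_norm_neg[of "gradient F x'" m'] norm_minus_commute)
  then have momentum': "(norm m')\<^sup>2 - L\<^sup>2 * E \<le> 2 * (gradient F x' \<bullet> m')"
    using zero_le_power2[of "norm (gradient F x')"] by linarith
  have "(norm u)\<^sup>2 + \<beta> * (1 - \<beta>) * (norm (m - m'))\<^sup>2 = \<beta> * (norm m)\<^sup>2 + (1 - \<beta>) * (norm m')\<^sup>2"
    unfolding u_def power2_norm_eq_inner
    by (simp add: inner_add inner_diff inner_commute algebra_simps)
  moreover have "0 \<le> \<beta> * (1 - \<beta>) * (norm (m - m'))\<^sup>2"
    using beta by auto
  ultimately have u_convex: "(norm u)\<^sup>2 \<le> \<beta> * (norm m)\<^sup>2 + (1 - \<beta>) * (norm m')\<^sup>2"
    by linarith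
  have "2 * (d \<bullet> u) = \<beta> * (2 * (d \<bullet> m)) + (1 - \<beta>) * (2 * (d \<bullet> m'))"
    by (simp add: u_def inner_add_right)
  moreover have "\<beta> * ((norm m)\<^sup>2 - L\<^sup>2 * e) \<le> \<beta> * (2 * (d \<bullet> m))"
    using momentum beta unfolding d_def by (intro mult_left_mono)
  moreover have "(1 - \<beta>) * ((norm m')\<^sup>2 + (norm d)\<^sup>2 - L\<^sup>2 * D) \<le> (1 - \<beta>) * (2 * (d \<bullet> m'))"
    using error_x beta by (intro mult_left_mono) auto
  ultimately have du: "(norm u)\<^sup>2 + (1 - \<beta>) * (norm d)\<^sup>2 - (1 - \<beta>) * L\<^sup>2 * D - \<beta> * L\<^sup>2 * e
      \<le> 2 * (d \<bullet> u)"
    using u_convex by (simp add: algebra_simps)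
  have descent: "F x' \<le> F x - \<eta> / 2 * (2 * (d \<bullet> u)) + \<eta> / 2 * (L * \<eta>) * (norm u)\<^sup>2"
    using descent_inequality[OF GDERIV_F gradient_F_lipschitz, of x' x]
    unfolding step d_def
    by (simp add: power_mult_distrib power2_eq_square mult_ac)
  have L_eta: "L * \<eta> \<le> 1 / 6"
  proof (rule power2_le_imp_le)
    show "(L * \<eta>)\<^sup>2 \<le> (1 / 6)\<^sup>2"
      using s_small by (simp add: s_def power_mult_distrib power_divide)
  qed simp
  \<comment> \<open>All error terms fit into the negative terms of the descent inequality, up to the \<open>\<sigma>\<close> term: the
    coefficient of \<open>(norm u)\<^sup>2\<close> is at most \<open>1/6 + 2 * 9/4 * 1/45 + 2 * 1/45 < 1\<close>, that of
    \<open>(1 - \<beta>) * (norm d)\<^sup>2\<close> is \<open>9/2 * 1/45 < 1/2\<close>.\<close>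
  have errors: "L * \<eta> * (norm u)\<^sup>2 + (1 - \<beta>) * L\<^sup>2 * D + \<beta> * L\<^sup>2 * E
      \<le> (norm u)\<^sup>2 + 1 / 2 * ((1 - \<beta>) * (norm d)\<^sup>2) + 9 / 2 * ((1 - \<beta>) * \<sigma>\<^sup>2 * s)"
  proof -
    have "(1 - \<beta>) * L\<^sup>2 * D + \<beta> * L\<^sup>2 * E
        \<le> (1 - \<beta>) * L\<^sup>2 * D + \<beta> * L\<^sup>2 * (2 * D + 2 * \<eta>\<^sup>2 * (norm u)\<^sup>2)"
      using E_le beta by (intro add_left_mono mult_left_mono) auto
    also have "\<dots> = (1 + \<beta>) * L\<^sup>2 * D + 2 * (\<beta> * (s * (norm u)\<^sup>2))"
      by (simp add: s_def algebra_simps)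
    also have "(1 + \<beta>) * L\<^sup>2 * D
        \<le> (1 + \<beta>) * L\<^sup>2 * (\<eta>\<^sup>2 * (9 / 4 * (norm u)\<^sup>2 + 9 / 2 * (1 - \<beta>)\<^sup>2 * V))"
      using drift(2) beta by (intro mult_left_mono) auto
    also have "\<dots> = 9 / 4 * ((1 + \<beta>) * (s * (norm u)\<^sup>2))
        + 9 / 2 * (((1 + \<beta>) * (1 - \<beta>)) * ((1 - \<beta>) * (s * V)))"
      by (simp add: s_def power2_eq_square algebra_simps add_divide_distrib)
    finally have sum_le: "(1 - \<beta>) * L\<^sup>2 * D + \<beta> * L\<^sup>2 * E \<le> 9 / 4 * ((1 + \<beta>) * (s * (norm u)\<^sup>2))
        + 9 / 2 * (((1 + \<beta>) * (1 - \<beta>)) * ((1 - \<beta>) * (s * V))) + 2 * (\<beta> * (s * (norm u)\<^sup>2))"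
      by linarith
    have su: "s * (norm u)\<^sup>2 \<le> 1 / 45 * (norm u)\<^sup>2"
      using s_small by (intro mult_right_mono) auto
    have su1: "(1 + \<beta>) * (s * (norm u)\<^sup>2) \<le> 2 * (s * (norm u)\<^sup>2)"
      using beta s0 by (intro mult_right_mono) auto
    have su2: "\<beta> * (s * (norm u)\<^sup>2) \<le> 1 * (s * (norm u)\<^sup>2)"
      using beta s0 by (intro mult_right_mono) auto
    have "(1 + \<beta>) * (1 - \<beta>) = 1 - \<beta>\<^sup>2"
      by (simp add: power2_eq_square algebra_simps)
    then have "((1 + \<beta>) * (1 - \<beta>)) * ((1 - \<beta>) * (s * V)) \<le> 1 * ((1 - \<beta>) * (s * V))"
      using beta s0 V0 by (intro mult_right_mono) auto
    also have "\<dots> = (1 - \<beta>) * ((s * \<Theta>) * (norm d)\<^sup>2) + (1 - \<beta>) * \<sigma>\<^sup>2 * s"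
      by (simp add: V_def algebra_simps)
    also have "(1 - \<beta>) * ((s * \<Theta>) * (norm d)\<^sup>2) \<le> (1 - \<beta>) * (1 / 45 * (norm d)\<^sup>2)"
      using s_Theta s0 beta by (intro mult_left_mono mult_right_mono) auto
    finally have sV: "((1 + \<beta>) * (1 - \<beta>)) * ((1 - \<beta>) * (s * V))
        \<le> 1 / 45 * ((1 - \<beta>) * (norm d)\<^sup>2) + (1 - \<beta>) * \<sigma>\<^sup>2 * s"
      by simp
    have Lu: "L * \<eta> * (norm u)\<^sup>2 \<le> 1 / 6 * (norm u)\<^sup>2"
      using L_eta by (intro mult_right_mono) auto
    have "0 \<le> (1 - \<beta>) * (norm d)\<^sup>2" "0 \<le> (norm u)\<^sup>2"
      using beta by auto
    then show ?thesis
      using sum_le su su1 su2 sV Lu by linarith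
  qed
  have "F x' + \<eta> * \<beta> / 2 * L\<^sup>2 * E + (1 - \<beta>) / 4 * (\<eta> * (norm d)\<^sup>2)
      \<le> F x + \<eta> * \<beta> / 2 * L\<^sup>2 * e + 9 / 4 * (1 - \<beta>) * \<sigma>\<^sup>2 * L\<^sup>2 * \<eta> ^ 3"
  proof -
    have "\<eta> / 2 * ((norm u)\<^sup>2 + (1 - \<beta>) * (norm d)\<^sup>2 - (1 - \<beta>) * L\<^sup>2 * D - \<beta> * L\<^sup>2 * e)
        \<le> \<eta> / 2 * (2 * (d \<bullet> u))"
      using du eta(1) by (intro mult_left_mono) auto
    moreover have "\<eta> / 2 * (L * \<eta> * (norm u)\<^sup>2 + (1 - \<beta>) * L\<^sup>2 * D + \<beta> * L\<^sup>2 * E)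
        \<le> \<eta> / 2 * ((norm u)\<^sup>2 + 1 / 2 * ((1 - \<beta>) * (norm d)\<^sup>2) + 9 / 2 * ((1 - \<beta>) * \<sigma>\<^sup>2 * s))"
      using errors eta(1) by (intro mult_left_mono) auto
    ultimately show ?thesis
      using descent
      by (simp add: s_def power2_eq_square power3_eq_cube algebra_simps diff_divide_distrib)
  qed
  moreover have "E \<ge> 0"
    by (simp add: E_def sum_nonneg)
  ultimately show ?thesis
    using momentum' unfolding d_def by blast
qed

section \<open>Telescoping over the epochs\<close>

text \<open>
  This holds for each fixed sequence of permutations. The momentum error left over by epoch \<open>t\<close>
  carries the factor \<open>\<eta> t\<close> and is used up in the next epoch with the smaller factor \<open>\<eta> (Suc t)\<close>.
\<close>

lemma smg_progress:
  assumes p: "\<And>t. t \<in> {1..T} \<Longrightarrow> p t permutes {1..n}"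
    and nonneg: "\<And>t. t \<in> {1..T} \<Longrightarrow> \<eta> t \<ge> 0"
    and decreasing: "\<And>t. 1 \<le> t \<Longrightarrow> t < T \<Longrightarrow> \<eta> (Suc t) \<le> \<eta> t"
    and small: "\<And>t. t \<in> {1..T} \<Longrightarrow> L\<^sup>2 * (\<eta> t)\<^sup>2 * (\<Theta> + 1) \<le> 1 / 45"
  shows "F (smg_iterate f n \<beta> \<eta> p w0 T)
      + (1 - \<beta>) / 4 * (\<Sum>t=1..T. \<eta> t * (norm (gradient F (smg_iterate f n \<beta> \<eta> p w0 (t - 1))))\<^sup>2)
    \<le> F w0 + 9 / 4 * (1 - \<beta>) * \<sigma>\<^sup>2 * L\<^sup>2 * (\<Sum>t=1..T. \<eta> t ^ 3)"
proof -
  define x where "x t = smg_iterate f n \<beta> \<eta> p w0 t" for t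
  define m where "m t = snd (smg_state f n \<beta> \<eta> p w0 t)" for t
  define a where "a t = \<eta> t * (norm (gradient F (x (t - 1))))\<^sup>2" for t
  define c where "c = 9 / 4 * (1 - \<beta>) * \<sigma>\<^sup>2 * L\<^sup>2"
  \<comment> \<open>The clause for \<open>t = 0\<close> is needed since \<open>\<eta> 0\<close> is arbitrary and not related to \<open>\<eta> 1\<close>.\<close>
  have "\<exists>e\<ge>0. (t = 0 \<longrightarrow> e = 0) \<and>
      (norm (m t))\<^sup>2 - L\<^sup>2 * e \<le> 2 * (gradient F (x t) \<bullet> m t) \<and>
      F (x t) + \<eta> t * \<beta> / 2 * L\<^sup>2 * e + (1 - \<beta>) / 4 * (\<Sum>s=1..t. a s)
        \<le> F w0 + c * (\<Sum>s=1..t. \<eta> s ^ 3)" if "t \<le> T" for t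
    using that
  proof (induction t)
    case 0
    show ?case
      by (intro exI[of _ 0]) (simp add: x_def m_def smg_iterate_def)
  next
    case (Suc t)
    then obtain e where e: "e \<ge> 0" "t = 0 \<longrightarrow> e = 0"
        "(norm (m t))\<^sup>2 - L\<^sup>2 * e \<le> 2 * (gradient F (x t) \<bullet> m t)"
        "F (x t) + \<eta> t * \<beta> / 2 * L\<^sup>2 * e + (1 - \<beta>) / 4 * (\<Sum>s=1..t. a s)
          \<le> F w0 + c * (\<Sum>s=1..t. \<eta> s ^ 3)"
      by auto
    have t: "Suc t \<in> {1..T}"
      using Suc.prems by simp
    obtain x' m\<^sub>n m' where
      epoch: "smg_epoch f n \<beta> (\<eta> (Suc t)) (p (Suc t)) (x t) (m t) n = (x', m\<^sub>n, m')"
      by (metis prod_cases3)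
    then have next_state: "x (Suc t) = x'" "m (Suc t) = m'"
      by (simp_all add: x_def m_def smg_iterate_def split_beta)
    obtain e' where e': "e' \<ge> 0" "(norm m')\<^sup>2 - L\<^sup>2 * e' \<le> 2 * (gradient F x' \<bullet> m')"
      "F x' + \<eta> (Suc t) * \<beta> / 2 * L\<^sup>2 * e' + (1 - \<beta>) / 4 * a (Suc t)
        \<le> F (x t) + \<eta> (Suc t) * \<beta> / 2 * L\<^sup>2 * e + c * \<eta> (Suc t) ^ 3"
      using smg_epoch_progress[OF p[OF t] nonneg[OF t] small[OF t] e(3) epoch]
      by (auto simp: a_def c_def)
    have "\<eta> (Suc t) * \<beta> / 2 * L\<^sup>2 * e \<le> \<eta> t * \<beta> / 2 * L\<^sup>2 * e"
    proof (cases "t = 0")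
      case False
      then have "\<eta> (Suc t) \<le> \<eta> t"
        using decreasing[of t] t by simp
      then show ?thesis
        using beta e(1) by (intro mult_right_mono divide_right_mono) auto
    qed (use e(2) in simp)
    then have "F x' + \<eta> (Suc t) * \<beta> / 2 * L\<^sup>2 * e' + (1 - \<beta>) / 4 * (\<Sum>s=1..Suc t. a s)
        \<le> F w0 + c * (\<Sum>s=1..Suc t. \<eta> s ^ 3)"
      using e(4) e'(3) by (simp add: distrib_left)
    then show ?case
      using e'(1,2) unfolding next_state by blast
  qed
  then obtain e where e: "e \<ge> 0" "T = 0 \<longrightarrow> e = 0"
      "F (x T) + \<eta> T * \<beta> / 2 * L\<^sup>2 * e + (1 - \<beta>) / 4 * (\<Sum>s=1..T. a s)
        \<le> F w0 + c * (\<Sum>s=1..T. \<eta> s ^ 3)"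
    by blast
  have "0 \<le> \<eta> T * \<beta> / 2 * L\<^sup>2 * e"
    using e(1,2) nonneg[of T] beta by (cases "T = 0") auto
  then show ?thesis
    using e(3) by (simp add: x_def a_def c_def)
qed

end

section \<open>The cosine learning rate\<close>

lemma sum_cos_pi_fractions:
  assumes "T \<ge> 1"
  shows "(\<Sum>t=1..T. cos (real t * pi / real T)) = - 1"
proof -
  let ?C = "\<Sum>t=1..<T. cos (real t * pi / real T)"
  \<comment> \<open>The reflection of \<open>t\<close> to \<open>T - t\<close> changes the sign of every term.\<close>
  have "?C = (\<Sum>t=1..<T. - cos (real t * pi / real T))"
  proof (rule sum.reindex_bij_witness[of _ "\<lambda>t. T - t" "\<lambda>t. T - t"])
    fix t assume "t \<in> {1..<T}"
    then have "real (T - t) * pi / real T = pi - real t * pi / real T"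
      by (simp add: of_nat_diff field_simps)
    then show "- cos (real (T - t) * pi / real T) = cos (real t * pi / real T)"
      by (simp add: cos_diff)
  qed auto
  then have "?C = 0"
    by (simp add: sum_negf)
  moreover have "{1..T} = insert T {1..<T}"
    using assms by auto
  ultimately show ?thesis
    using assms by simp
qed

text \<open>The cosine learning rate over \<open>T\<close> epochs. It is prescribed only at the indices from 1 to \<open>T\<close>, and
  it vanishes at \<open>T\<close>.\<close>

locale cosine_rate =
  fixes \<eta> :: "nat \<Rightarrow> real" and \<gamma> :: real and T :: nat
  assumes eta: "t \<in> {1..T} \<Longrightarrow> \<eta> t = \<gamma> / real T powr (1 / 3) * (1 + cos (real t * pi / real T))"
    and gamma_pos: "\<gamma> > 0"
    and T: "T \<ge> 2"
begin

lemma T_powr_third: "real T powr (1 / 3) > 0" "(real T powr (1 / 3)) ^ 3 = real T"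
    "real T powr (2 / 3) = (real T powr (1 / 3))\<^sup>2"
  using T by (simp_all add: powr_power)

lemma eta_nonneg: "t \<in> {1..T} \<Longrightarrow> \<eta> t \<ge> 0"
proof -
  assume t: "t \<in> {1..T}"
  have "0 \<le> 1 + cos (real t * pi / real T)"
    using cos_ge_minus_one[of "real t * pi / real T"] by linarith
  then show ?thesis
    unfolding eta[OF t] using gamma_pos by (intro mult_nonneg_nonneg divide_nonneg_nonneg) auto
qed

lemma eta_decreasing:
  assumes "1 \<le> t" "t < T"
  shows "\<eta> (Suc t) \<le> \<eta> t"
proof -
  have "real (Suc t) * pi / real T \<le> pi"
    using assms mult_right_mono[of "real (Suc t)" "real T" pi]
    by (simp add: pos_divide_le_eq mult.commute del: of_nat_Suc)
  moreover have "real t * pi / real T \<le> real (Suc t) * pi / real T"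
    by (intro divide_right_mono mult_right_mono) auto
  ultimately have "cos (real (Suc t) * pi / real T) \<le> cos (real t * pi / real T)"
    by (intro cos_monotone_0_pi_le) auto
  then show ?thesis
    using assms gamma_pos by (simp add: eta mult_left_mono divide_right_mono)
qed

text \<open>The cosines sum to \<open>-1\<close>, and \<open>T - 1 \<ge> T / 2\<close>.\<close>

lemma sum_eta_ge: "\<gamma> * (real T powr (1 / 3))\<^sup>2 / 2 \<le> (\<Sum>t=1..T. \<eta> t)"
proof -
  let ?r = "real T powr (1 / 3)"
  have "(\<Sum>t=1..T. \<eta> t) = \<gamma> / ?r * (\<Sum>t=1..T. 1 + cos (real t * pi / real T))"
    by (simp add: eta sum_distrib_left)
  also have "\<dots> = \<gamma> / ?r * (real T - 1)"
    using T sum_cos_pi_fractions[of T] by (simp add: sum.distrib)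
  also have "\<dots> \<ge> \<gamma> / ?r * (real T / 2)"
    using T gamma_pos by (intro mult_left_mono) auto
  also have "\<gamma> / ?r * (real T / 2) = \<gamma> / ?r * (?r ^ 3 / 2)"
    by (simp only: T_powr_third(2))
  also have "\<dots> = \<gamma> * ?r\<^sup>2 / 2"
    using T_powr_third(1) by (simp add: power2_eq_square power3_eq_cube)
  finally show ?thesis .
qed

lemma sum_eta_cubed_le: "(\<Sum>t=1..T. \<eta> t ^ 3) \<le> 8 * \<gamma> ^ 3"
proof -
  let ?r = "real T powr (1 / 3)"
  have "(\<Sum>t=1..T. \<eta> t ^ 3) \<le> (\<Sum>t=1..T. (\<gamma> / ?r * 2) ^ 3)"
  proof (intro sum_mono power_mono)
    fix t assume t: "t \<in> {1..T}"
    show "\<eta> t \<le> \<gamma> / ?r * 2"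
      unfolding eta[OF t] using gamma_pos cos_le_one[of "real t * pi / real T"]
      by (intro mult_left_mono) auto
  qed (rule eta_nonneg)
  also have "\<dots> = 8 * \<gamma> ^ 3 * (real T / ?r ^ 3)"
    by (simp add: power_mult_distrib power_divide)
  also have "\<dots> = 8 * \<gamma> ^ 3"
    using T by (simp only: T_powr_third(2)) simp
  finally show ?thesis .
qed

end

section \<open>Independent random variables with finitely many values\<close>

context prob_space
begin

lemma sum_prob_values:
  assumes Y: "random_variable N Y" and fin: "finite (space N)"
    and single: "\<And>y. y \<in> space N \<Longrightarrow> {y} \<in> sets N"
  shows "(\<Sum>y\<in>space N. prob {\<omega> \<in> space M. Y \<omega> = y}) = 1"
proof -
  have "{\<omega> \<in> space M. Y \<omega> = y} \<in> events" if "y \<in> space N" for y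
  proof -
    have "{\<omega> \<in> space M. Y \<omega> = y} = Y -` {y} \<inter> space M"
      by auto
    then show ?thesis
      using measurable_sets[OF Y single[OF that]] by simp
  qed
  then have "(\<Sum>y\<in>space N. prob {\<omega> \<in> space M. Y \<omega> = y}) =
      prob (\<Union>y\<in>space N. {\<omega> \<in> space M. Y \<omega> = y})"
    using fin by (intro finite_measure_finite_Union[symmetric]) (auto simp: disjoint_family_on_def)
  also have "(\<Union>y\<in>space N. {\<omega> \<in> space M. Y \<omega> = y}) = space M"
    using measurable_space[OF Y] by auto
  finally show ?thesis
    by (simp add: prob_space)
qed

lemma expectation_indep_rvs_finite:
  fixes h :: "'b \<Rightarrow> 'c \<Rightarrow> real"
  assumes indep: "indep_rvs N X N' Y"
    and fin: "finite (space N)" "finite (space N')"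
    and single: "\<And>x. x \<in> space N \<Longrightarrow> {x} \<in> sets N" "\<And>y. y \<in> space N' \<Longrightarrow> {y} \<in> sets N'"
  shows "expectation (\<lambda>\<omega>. h (X \<omega>) (Y \<omega>)) =
    (\<Sum>y\<in>space N'. prob {\<omega> \<in> space M. Y \<omega> = y} *
      (\<Sum>x\<in>space N. prob {\<omega> \<in> space M. X \<omega> = x} * h x y))"
proof -
  have X: "random_variable N X" and Y: "random_variable N' Y"
    and indep_sets: "indep_set (sets (vimage_algebra (space M) X N))
      (sets (vimage_algebra (space M) Y N'))"
    using indep by (auto simp: indep_rvs_def)
  \<comment> \<open>The integrand is a finite linear combination of indicators of the joint level sets.\<close>
  define E where "E x y = (X -` {x} \<inter> space M) \<inter> (Y -` {y} \<inter> space M)" for x y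
  have E: "E x y \<in> events" if "x \<in> space N" "y \<in> space N'" for x y
    unfolding E_def using measurable_sets[OF X single(1)] measurable_sets[OF Y single(2)] that by blast
  have prob_E: "prob (E x y) = prob {\<omega> \<in> space M. X \<omega> = x} * prob {\<omega> \<in> space M. Y \<omega> = y}"
    if "x \<in> space N" "y \<in> space N'" for x y
  proof -
    have "prob (E x y) = prob (X -` {x} \<inter> space M) * prob (Y -` {y} \<inter> space M)"
      unfolding E_def using single that
      by (intro indep_setD[OF indep_sets] in_vimage_algebra)
    then show ?thesis
      by (simp add: vimage_def Int_def conj_commute)
  qed
  have "h (X \<omega>) (Y \<omega>) = (\<Sum>y\<in>space N'. \<Sum>x\<in>space N. h x y * indicator (E x y) \<omega>)"
    if "\<omega> \<in> space M" for \<omega>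
  proof -
    have "h x y * indicator (E x y) \<omega> =
        (if x = X \<omega> then if y = Y \<omega> then h (X \<omega>) (Y \<omega>) else 0 else 0)" for x y
      using that by (auto simp: E_def)
    moreover have "X \<omega> \<in> space N" "Y \<omega> \<in> space N'"
      using measurable_space[OF X that] measurable_space[OF Y that] by auto
    ultimately show ?thesis
      using fin by simp
  qed
  then have "expectation (\<lambda>\<omega>. h (X \<omega>) (Y \<omega>)) =
      expectation (\<lambda>\<omega>. \<Sum>y\<in>space N'. \<Sum>x\<in>space N. h x y * indicator (E x y) \<omega>)"
    by (intro Bochner_Integration.integral_cong) auto
  also have "\<dots> = (\<Sum>y\<in>space N'. \<Sum>x\<in>space N. h x y * prob (E x y))"
  proof -
    have int: "integrable M (\<lambda>\<omega>. h x y * indicator (E x y) \<omega>)" if "x \<in> space N" "y \<in> space N'" for x y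
      using E[OF that] by (simp add: integrable_real_indicator emeasure_eq_measure)
    have expectation_E: "expectation (\<lambda>\<omega>. h x y * indicator (E x y) \<omega>) = h x y * prob (E x y)"
      if "x \<in> space N" "y \<in> space N'" for x y
      using E[OF that] by simp
    have "expectation (\<lambda>\<omega>. \<Sum>y\<in>space N'. \<Sum>x\<in>space N. h x y * indicator (E x y) \<omega>) =
        (\<Sum>y\<in>space N'. expectation (\<lambda>\<omega>. \<Sum>x\<in>space N. h x y * indicator (E x y) \<omega>))"
      by (intro Bochner_Integration.integral_sum Bochner_Integration.integrable_sum int)
    also have "\<dots> = (\<Sum>y\<in>space N'. \<Sum>x\<in>space N. expectation (\<lambda>\<omega>. h x y * indicator (E x y) \<omega>))"
      by (intro sum.cong refl Bochner_Integration.integral_sum int)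
    also have "\<dots> = (\<Sum>y\<in>space N'. \<Sum>x\<in>space N. h x y * prob (E x y))"
      by (intro sum.cong refl expectation_E)
    finally show ?thesis .
  qed
  also have "\<dots> = (\<Sum>y\<in>space N'. prob {\<omega> \<in> space M. Y \<omega> = y} *
      (\<Sum>x\<in>space N. prob {\<omega> \<in> space M. X \<omega> = x} * h x y))"
    by (simp add: prob_E sum_distrib_left mult_ac)
  finally show ?thesis .
qed

lemma expectation_indep_rvs_finite_le:
  fixes h :: "'b \<Rightarrow> 'c \<Rightarrow> real"
  assumes indep: "indep_rvs N X N' Y"
    and fin: "finite (space N)" "finite (space N')"
    and single: "\<And>x. x \<in> space N \<Longrightarrow> {x} \<in> sets N" "\<And>y. y \<in> space N' \<Longrightarrow> {y} \<in> sets N'"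
    and bound: "\<And>y. y \<in> space N' \<Longrightarrow> (\<Sum>x\<in>space N. prob {\<omega> \<in> space M. X \<omega> = x} * h x y) \<le> B"
  shows "expectation (\<lambda>\<omega>. h (X \<omega>) (Y \<omega>)) \<le> B"
proof -
  have "expectation (\<lambda>\<omega>. h (X \<omega>) (Y \<omega>)) \<le> (\<Sum>y\<in>space N'. prob {\<omega> \<in> space M. Y \<omega> = y} * B)"
    using expectation_indep_rvs_finite[OF indep fin single, of h]
    by (simp add: sum_mono mult_left_mono bound)
  also have "\<dots> = B"
    using sum_prob_values[of Y N'] indep fin(2) single(2)
    by (simp add: indep_rvs_def sum_distrib_right[symmetric])
  finally show ?thesis .
qed

end

section \<open>The convergence rate\<close>

lemma smg_iterate_cong:
  assumes "\<And>s. s \<in> {1..t} \<Longrightarrow> p s = p' s"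
  shows "smg_iterate f n \<beta> \<eta> p w0 t = smg_iterate f n \<beta> \<eta> p' w0 t"
proof -
  have "smg_state f n \<beta> \<eta> p w0 t = smg_state f n \<beta> \<eta> p' w0 t"
    using assms by (induction t) auto
  then show ?thesis
    by (simp add: smg_iterate_def)
qed

theorem corollary4:
  fixes f :: "nat \<Rightarrow> real ^ 'd \<Rightarrow> real"
    and F :: "real ^ 'd \<Rightarrow> real"
    and w0 :: "real ^ 'd"
    and n T :: nat
    and L \<Theta> \<sigma> \<beta> \<gamma> K F_star :: real
    and \<eta> :: "nat \<Rightarrow> real"
    and M :: "'s measure"
    and perm :: "nat \<Rightarrow> 's \<Rightarrow> nat \<Rightarrow> nat"
    and \<tau> :: "'s \<Rightarrow> nat"
    and w_hat :: "'s \<Rightarrow> real ^ 'd"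
  assumes n: "n \<ge> 1"
    and F: "F = finite_sum_objective n f"
    and differentiable: "\<And>i w. i \<in> {1..n} \<Longrightarrow> f i differentiable (at w)"
    and bounded_below: "bdd_below (range F)"
    and F_star: "F_star = (INF w. F w)"
    and L_pos: "L > 0"
    and smooth: "\<And>i w w'. i \<in> {1..n} \<Longrightarrow>
      norm (gradient (f i) w - gradient (f i) w') \<le> L * norm (w - w')"
    and Theta_nonneg: "\<Theta> \<ge> 0"
    and sigma_nonneg: "\<sigma> \<ge> 0"
    and variance: "\<And>w. (1 / real n) * (\<Sum>i=1..n. (norm (gradient (f i) w - gradient F w))\<^sup>2)
      \<le> \<Theta> * (norm (gradient F w))\<^sup>2 + \<sigma>\<^sup>2"
    and beta: "0 \<le> \<beta>" "\<beta> < 1"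
    and K: "K = max (5 / 2) (9 * (5 - 3 * \<beta>) * (\<Theta> + 1) / (1 - \<beta>))"
    and T: "T \<ge> 2"
    and gamma_pos: "\<gamma> > 0"
    and eta: "\<And>t. t \<in> {1..T} \<Longrightarrow>
      \<eta> t = \<gamma> / real T powr (1 / 3) * (1 + cos (real t * pi / real T))"
    and eta_le: "\<And>t. t \<in> {1..T} \<Longrightarrow> \<eta> t \<le> 1 / (L * sqrt K)"
    and prob_space: "prob_space M"
    and perm: "\<And>t. t \<in> {1..T} \<Longrightarrow> perm t \<in> measurable M (perm_space n)"
    and tau: "\<tau> \<in> measurable M (count_space {1..T})"
    and tau_distr: "\<And>t. t \<in> {1..T} \<Longrightarrow>
      measure M {\<omega> \<in> space M. \<tau> \<omega> = t} = \<eta> t / (\<Sum>s=1..T. \<eta> s)"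
    and indep: "prob_space.indep_rvs M
      (count_space {1..T}) \<tau>
      (PiM {1..T} (\<lambda>_. perm_space n)) (\<lambda>\<omega>. \<lambda>t\<in>{1..T}. perm t \<omega>)"
    and w_hat: "\<And>\<omega>. \<omega> \<in> space M \<Longrightarrow>
      w_hat \<omega> = smg_iterate f n \<beta> \<eta> (\<lambda>t. perm t \<omega>) w0 (\<tau> \<omega> - 1)"
  shows "(\<integral>\<omega>. (norm (gradient F (w_hat \<omega>)))\<^sup>2 \<partial>M)
    \<le> 1 / real T powr (2 / 3) *
       (8 * (F w0 - F_star) / ((1 - \<beta>) * \<gamma>)
        + 144 * \<sigma>\<^sup>2 * (5 - 3 * \<beta>) * L\<^sup>2 * \<gamma>\<^sup>2 / (1 - \<beta>))"
proof -
  interpret prob_space M by (rule prob_space)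
  interpret smg_problem f F n L \<Theta> \<sigma> \<beta>
    using n F differentiable smooth Theta_nonneg variance beta by unfold_locales
  interpret cosine_rate \<eta> \<gamma> T
    using eta gamma_pos T by unfold_locales
  define r where "r = real T powr (1 / 3)"
  define S where "S = (\<Sum>t=1..T. \<eta> t)"
  define \<Delta> where "\<Delta> = F w0 - F_star"
  define h where "h t q = (norm (gradient F (smg_iterate f n \<beta> \<eta> q w0 (t - 1))))\<^sup>2" for t q
  define B where "B = 1 / real T powr (2 / 3) *
       (8 * (F w0 - F_star) / ((1 - \<beta>) * \<gamma>)
        + 144 * \<sigma>\<^sup>2 * (5 - 3 * \<beta>) * L\<^sup>2 * \<gamma>\<^sup>2 / (1 - \<beta>))"
  have r: "r > 0" "real T powr (2 / 3) = r\<^sup>2"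
    using T_powr_third by (simp_all add: r_def)
  have S: "\<gamma> * r\<^sup>2 / 2 \<le> S"
    using sum_eta_ge by (simp add: r_def S_def)
  moreover have "0 < \<gamma> * r\<^sup>2 / 2"
    using r(1) gamma_pos by simp
  ultimately have S_pos: "S > 0"
    by linarith
  have F_star_le: "F_star \<le> F x" for x
    unfolding F_star using bounded_below by (intro cINF_lower) auto
  have small: "L\<^sup>2 * (\<eta> t)\<^sup>2 * (\<Theta> + 1) \<le> 1 / 45" if t: "t \<in> {1..T}" for t
  proof -
    have "45 * (\<Theta> + 1) \<le> 9 * (5 - 3 * \<beta>) * (\<Theta> + 1) / (1 - \<beta>)"
      using beta Theta_nonneg by (simp add: field_simps mult_nonneg_nonneg)
    then have K_ge: "45 * (\<Theta> + 1) \<le> K"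
      by (simp add: K)
    then have K_pos: "K > 0"
      using Theta_nonneg by simp
    have "(L * \<eta> t)\<^sup>2 \<le> (1 / sqrt K)\<^sup>2"
      using eta_le[OF t] eta_nonneg[OF t] L_pos K_pos
      by (intro power_mono) (auto simp: field_simps)
    then have "L\<^sup>2 * (\<eta> t)\<^sup>2 * (\<Theta> + 1) \<le> 1 / K * (\<Theta> + 1)"
      using Theta_nonneg K_pos by (intro mult_right_mono) (auto simp: power_mult_distrib power_divide)
    also have "\<dots> \<le> 1 / 45"
      using K_ge K_pos by (simp add: field_simps)
    finally show ?thesis .
  qed
  \<comment> \<open>For a fixed sequence \<open>q\<close> of permutations, the average over the output index alone is bounded.\<close>
  have weighted: "(\<Sum>t=1..T. \<eta> t / S * h t q) \<le> B" if q: "\<And>t. t \<in> {1..T} \<Longrightarrow> q t permutes {1..n}" for q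
  proof -
    define A where "A = (\<Sum>t=1..T. \<eta> t * h t q)"
    have A_nonneg: "A \<ge> 0"
      unfolding A_def h_def using eta_nonneg by (intro sum_nonneg) auto
    have "F_star + (1 - \<beta>) / 4 * A \<le> F w0 + 9 / 4 * (1 - \<beta>) * \<sigma>\<^sup>2 * L\<^sup>2 * (\<Sum>t=1..T. \<eta> t ^ 3)"
      using smg_progress[of T q \<eta>, OF q eta_nonneg eta_decreasing small, of w0]
        F_star_le[of "smg_iterate f n \<beta> \<eta> q w0 T"]
      by (simp add: A_def h_def)
    also have "\<dots> \<le> F w0 + 9 / 4 * (1 - \<beta>) * \<sigma>\<^sup>2 * L\<^sup>2 * (8 * \<gamma> ^ 3)"
      using sum_eta_cubed_le beta by (intro add_left_mono mult_left_mono) auto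
    finally have "(1 - \<beta>) / 4 * A \<le> \<Delta> + (1 - \<beta>) * (18 * \<sigma>\<^sup>2 * L\<^sup>2 * \<gamma> ^ 3)"
      by (simp add: \<Delta>_def algebra_simps diff_divide_distrib)
    then have "A \<le> 4 * \<Delta> / (1 - \<beta>) + 72 * \<sigma>\<^sup>2 * L\<^sup>2 * \<gamma> ^ 3"
      using beta by (simp add: field_simps)
    then have "A * (2 / (\<gamma> * r\<^sup>2)) \<le> (4 * \<Delta> / (1 - \<beta>) + 72 * \<sigma>\<^sup>2 * L\<^sup>2 * \<gamma> ^ 3) * (2 / (\<gamma> * r\<^sup>2))"
      using gamma_pos by (intro mult_right_mono) auto
    also have "\<dots> = 1 / r\<^sup>2 * (8 * \<Delta> / ((1 - \<beta>) * \<gamma>) + 144 * \<sigma>\<^sup>2 * L\<^sup>2 * \<gamma>\<^sup>2 * 1)"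
      using gamma_pos r(1) beta by (simp add: field_simps power2_eq_square power3_eq_cube)
    \<comment> \<open>The factor 1 is enlarged to \<open>(5 - 3 * \<beta>) / (1 - \<beta>)\<close>, which is at least 5.\<close>
    also have "\<dots> \<le> 1 / r\<^sup>2 * (8 * \<Delta> / ((1 - \<beta>) * \<gamma>)
        + 144 * \<sigma>\<^sup>2 * L\<^sup>2 * \<gamma>\<^sup>2 * ((5 - 3 * \<beta>) / (1 - \<beta>)))"
      using beta by (intro mult_left_mono add_left_mono) auto
    also have "\<dots> = B"
      by (simp add: B_def \<Delta>_def r(2) mult_ac)
    finally have "A * (2 / (\<gamma> * r\<^sup>2)) \<le> B" .
    moreover have "A * (1 / S) \<le> A * (2 / (\<gamma> * r\<^sup>2))"
      using S S_pos gamma_pos r(1) A_nonneg by (intro mult_left_mono) (auto simp: field_simps)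
    moreover have "(\<Sum>t=1..T. \<eta> t / S * h t q) = A * (1 / S)"
      by (simp add: A_def sum_divide_distrib)
    ultimately show ?thesis
      by linarith
  qed
  let ?N' = "PiM {1..T} (\<lambda>_. perm_space n)"
  let ?X = "\<lambda>\<omega>. \<lambda>t\<in>{1..T}. perm t \<omega>"
  have space_N': "space ?N' = {1..T} \<rightarrow>\<^sub>E {p. p permutes {1..n}}"
    by (simp add: space_PiM)
  have "(\<integral>\<omega>. (norm (gradient F (w_hat \<omega>)))\<^sup>2 \<partial>M) = expectation (\<lambda>\<omega>. h (\<tau> \<omega>) (?X \<omega>))"
  proof (rule Bochner_Integration.integral_cong)
    fix \<omega> assume \<omega>: "\<omega> \<in> space M"
    then have "\<tau> \<omega> \<le> T"
      using measurable_space[OF tau] by auto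
    then have "smg_iterate f n \<beta> \<eta> (\<lambda>t. perm t \<omega>) w0 (\<tau> \<omega> - 1)
        = smg_iterate f n \<beta> \<eta> (?X \<omega>) w0 (\<tau> \<omega> - 1)"
      by (intro smg_iterate_cong) auto
    then show "(norm (gradient F (w_hat \<omega>)))\<^sup>2 = h (\<tau> \<omega>) (?X \<omega>)"
      by (simp add: h_def w_hat[OF \<omega>])
  qed simp
  also have "\<dots> \<le> B"
  proof (rule expectation_indep_rvs_finite_le[OF indep])
    show "finite (space ?N')"
      unfolding space_N' by (intro finite_PiE) (auto simp: finite_permutations)
    fix q assume q: "q \<in> space ?N'"
    then have q_perm: "q \<in> {1..T} \<rightarrow>\<^sub>E {p. p permutes {1..n}}"
      by (simp only: space_N')
    have "PiE {1..T} (\<lambda>t. {q t}) \<in> sets ?N'"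
      using q_perm by (intro sets_PiM_I_finite) auto
    moreover have "PiE {1..T} (\<lambda>t. {q t}) = {q}"
      using q_perm by (intro PiE_singleton) (auto simp: PiE_iff)
    ultimately show "{q} \<in> sets ?N'"
      by simp
    have "(\<Sum>t=1..T. prob {\<omega> \<in> space M. \<tau> \<omega> = t} * h t q) = (\<Sum>t=1..T. \<eta> t / S * h t q)"
      by (simp add: tau_distr S_def)
    also have "\<dots> \<le> B"
      using q_perm by (intro weighted) auto
    finally show "(\<Sum>t\<in>space (count_space {1..T}). prob {\<omega> \<in> space M. \<tau> \<omega> = t} * h t q) \<le> B"
      by simp
  qed auto
  finally show ?thesis
    unfolding B_def .
qed

end
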